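(* Every quadrangulation $Q$, with its vertices properly colored black and white, admits a strong labeling.
   Context: A quadrangulation is a simple plane graph with at least four vertices all of whose faces (including the outer face) are bounded by $4$-cycles (equivalently, a maximal bipartite plane graph). An angle is an incidence of a vertex with a face. A strong labeling of $Q$ is a map from the angles of $Q$ to $\{0,1\}$ such that: (G0) the two black vertices on the outer face are named $s_0$ and $s_1$, and all angles at $s_i$ are labeled $i$; (G1) for each vertex $v\notin\{s_0,s_1\}$ the labels around $v$ form one non-empty cyclic interval of $1$s and one non-empty cyclic interval of $0$s; (G2) for each edge, the two labels on the two sides of the edge coincide at one endpoint and differ at the other; (G3) the labels in each bounded face, read cyclically, are $0,0,1,1$, and reading the labels of the outer face in clockwise order starting at $s_0$ they are $0,0,1,1$. *)

theory Defs
  imports Main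
begin

text \<open>Combinatorial plane graphs (rotation systems).
  A graph is given by a finite vertex set V and a symmetric irreflexive
  dart relation E (each undirected edge {u,v} appears as the two darts
  (u,v) and (v,u)).  The embedding is given by rot: for a vertex v,
  rot v is the successor function of the counterclockwise cyclic order of
  the neighbours of v.  Faces are the orbits of the face-walk map fnext,
  which follows a face keeping it on the right-hand side (so bounded faces
  are traversed clockwise).  Planarity (sphere embedding) of a connected
  rotation system is expressed by Euler's formula V - E + F = 2; the plane
  graph is obtained by designating the outer face via one of its darts.\<close>

definition nbrs :: "('v \<times> 'v) set \<Rightarrow> 'v \<Rightarrow> 'v set" where
  "nbrs E v = {u. (v, u) \<in> E}"

definition fnext :: "('v \<Rightarrow> 'v \<Rightarrow> 'v) \<Rightarrow> 'v \<times> 'v \<Rightarrow> 'v \<times> 'v" where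
  "fnext rot d = (snd d, rot (snd d) (fst d))"

definition face_of :: "('v \<Rightarrow> 'v \<Rightarrow> 'v) \<Rightarrow> 'v \<times> 'v \<Rightarrow> ('v \<times> 'v) set" where
  "face_of rot d = {(fnext rot ^^ k) d | k. True}"

definition faces :: "('v \<times> 'v) set \<Rightarrow> ('v \<Rightarrow> 'v \<Rightarrow> 'v) \<Rightarrow> ('v \<times> 'v) set set" where
  "faces E rot = face_of rot ` E"

definition simple_graph :: "'v set \<Rightarrow> ('v \<times> 'v) set \<Rightarrow> bool" where
  "simple_graph V E \<longleftrightarrow> finite V \<and> E \<subseteq> V \<times> V \<and> sym E \<and> (\<forall>v. (v, v) \<notin> E)"

definition connected_graph :: "'v set \<Rightarrow> ('v \<times> 'v) set \<Rightarrow> bool" where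
  "connected_graph V E \<longleftrightarrow> (\<forall>u\<in>V. \<forall>v\<in>V. (u, v) \<in> E\<^sup>*)"

definition rotation_system :: "'v set \<Rightarrow> ('v \<times> 'v) set \<Rightarrow> ('v \<Rightarrow> 'v \<Rightarrow> 'v) \<Rightarrow> bool" where
  "rotation_system V E rot \<longleftrightarrow>
     (\<forall>v\<in>V. bij_betw (rot v) (nbrs E v) (nbrs E v) \<and>
       (\<forall>u\<in>nbrs E v. \<forall>w\<in>nbrs E v. \<exists>k. (rot v ^^ k) u = w))"

text \<open>Connected simple graph with a rotation system of genus 0 (Euler: V - E/2 + F = 2).\<close>
definition plane_map :: "'v set \<Rightarrow> ('v \<times> 'v) set \<Rightarrow> ('v \<Rightarrow> 'v \<Rightarrow> 'v) \<Rightarrow> bool" where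
  "plane_map V E rot \<longleftrightarrow> simple_graph V E \<and> connected_graph V E \<and> rotation_system V E rot
     \<and> 2 * card V + 2 * card (faces E rot) = card E + 4"

text \<open>Quadrangulation: at least four vertices, every face bounded by a 4-cycle.\<close>
definition quadrangulation :: "'v set \<Rightarrow> ('v \<times> 'v) set \<Rightarrow> ('v \<Rightarrow> 'v \<Rightarrow> 'v) \<Rightarrow> bool" where
  "quadrangulation V E rot \<longleftrightarrow> plane_map V E rot \<and> card V \<ge> 4 \<and>
     (\<forall>d\<in>E. (fnext rot ^^ 4) d = d \<and>
        distinct [snd d, snd (fnext rot d), snd ((fnext rot ^^ 2) d), snd ((fnext rot ^^ 3) d)])"

definition proper_2coloring :: "('v \<times> 'v) set \<Rightarrow> ('v \<Rightarrow> bool) \<Rightarrow> bool" where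
  "proper_2coloring E black \<longleftrightarrow> (\<forall>(u, v)\<in>E. black u \<noteq> black v)"

text \<open>Angles: the angle (vertex-face incidence) represented by the dart d = (u,v)
  is the corner at v between u and rot v u, lying in the face of d.
  A labeling assigns lab d to this angle.\<close>

definition strong_labeling_named ::
  "'v set \<Rightarrow> ('v \<times> 'v) set \<Rightarrow> ('v \<Rightarrow> 'v \<Rightarrow> 'v) \<Rightarrow> 'v \<times> 'v \<Rightarrow> ('v \<Rightarrow> bool)
     \<Rightarrow> 'v \<Rightarrow> 'v \<Rightarrow> ('v \<times> 'v \<Rightarrow> nat) \<Rightarrow> bool" where
  "strong_labeling_named V E rot out black s0 s1 lab \<longleftrightarrow>
     \<comment> \<open>s0, s1 are the two black vertices of the outer face\<close>
     s0 \<noteq> s1 \<and> black s0 \<and> black s1 \<and>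
     s0 \<in> snd ` face_of rot out \<and> s1 \<in> snd ` face_of rot out \<and>
     \<comment> \<open>labels in {0,1}\<close>
     (\<forall>d\<in>E. lab d \<in> {0, 1}) \<and>
     \<comment> \<open>(G0)\<close>
     (\<forall>d\<in>E. (snd d = s0 \<longrightarrow> lab d = 0) \<and> (snd d = s1 \<longrightarrow> lab d = 1)) \<and>
     \<comment> \<open>(G1): around v (in rotation order) one nonempty interval of 1s, one nonempty interval of 0s\<close>
     (\<forall>v\<in>V - {s0, s1}. \<exists>a\<in>nbrs E v. \<exists>k. 0 < k \<and> k < card (nbrs E v) \<and>
        (\<forall>j<card (nbrs E v). lab ((rot v ^^ j) a, v) = (if j < k then 1 else 0))) \<and>
     \<comment> \<open>(G2): at endpoint v of edge uv the two angles beside the edge are the darts (u,v), (w,v)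
        with rot v w = u; they coincide at exactly one endpoint\<close>
     (\<forall>(u, v)\<in>E. \<forall>w\<in>nbrs E v. \<forall>w'\<in>nbrs E u. rot v w = u \<longrightarrow> rot u w' = v \<longrightarrow>
        ((lab (u, v) = lab (w, v)) \<longleftrightarrow> (lab (v, u) \<noteq> lab (w', u)))) \<and>
     \<comment> \<open>(G3) bounded faces: cyclically 0,0,1,1\<close>
     (\<forall>d\<in>E. face_of rot d \<noteq> face_of rot out \<longrightarrow>
        (\<exists>e\<in>face_of rot d. lab e = 0 \<and> lab (fnext rot e) = 0 \<and>
           lab ((fnext rot ^^ 2) e) = 1 \<and> lab ((fnext rot ^^ 3) e) = 1)) \<and>
     \<comment> \<open>(G3) outer face: the walk is s0 -> x -> s1 -> y -> s0 (counterclockwise in the plane),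
        so the clockwise reading s0, y, s1, x must be 0,0,1,1\<close>
     (\<forall>e\<in>face_of rot out. snd e = s0 \<longrightarrow>
        lab e = 0 \<and> lab ((fnext rot ^^ 3) e) = 0 \<and>
        lab ((fnext rot ^^ 2) e) = 1 \<and> lab (fnext rot e) = 1)"

definition strong_labeling ::
  "'v set \<Rightarrow> ('v \<times> 'v) set \<Rightarrow> ('v \<Rightarrow> 'v \<Rightarrow> 'v) \<Rightarrow> 'v \<times> 'v \<Rightarrow> ('v \<Rightarrow> bool)
     \<Rightarrow> ('v \<times> 'v \<Rightarrow> nat) \<Rightarrow> bool" where
  "strong_labeling V E rot out black lab \<longleftrightarrow>
     (\<exists>s0 s1. strong_labeling_named V E rot out black s0 s1 lab)"

end

theory Submission
  imports Defs
begin

text \<open>In a strong labeling, orient each edge away from the endpoint where the labels on its two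
  sides differ. Then every vertex other than s0 and s1 has out-degree 2, and s0, s1 are sinks.
  Moreover, in a walk around a face with the face on the right, the label changes exactly on the
  steps from a black to a white vertex, whatever the orientation.

  Conversely, any such 2-orientation prescribes all label differences between neighbouring angles.
  The prescription is consistent around every vertex, edge and face, and hence globally, because
  the first cohomology of the sphere with coefficients mod 2 vanishes; the latter follows from
  Euler's formula by counting dimensions. A 2-orientation exists by Hall's theorem: for every set
  of at least three vertices, Euler's inequality for the induced subgraph (again by counting
  dimensions) and the fact that even subgraphs of a simple bipartite graph have at least four
  edges give at most 2n - 4 induced edges.\<close>

subsection \<open>Counting\<close>

lemma odd_card_sym_diff:
  assumes "finite A" "finite B"
  shows "odd (card (sym_diff A B)) \<longleftrightarrow> odd (card A) \<noteq> odd (card B)"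
proof -
  have "card (sym_diff A B) = card (A - B) + card (B - A)"
    using assms by (intro card_Un_disjoint) auto
  moreover have "card A = card (A - B) + card (A \<inter> B)"
    using assms by (subst card_Un_disjoint[symmetric]) (auto intro: arg_cong[where f = card])
  moreover have "card B = card (B - A) + card (A \<inter> B)"
    using assms by (subst card_Un_disjoint[symmetric]) (auto intro: arg_cong[where f = card])
  ultimately show ?thesis by presburger
qed

lemma odd_card_Collect_neq:
  assumes "finite N"
  shows "odd (card {u \<in> N. p u \<noteq> q u}) \<longleftrightarrow> odd (card {u \<in> N. p u}) \<noteq> odd (card {u \<in> N. q u})"
proof -
  have "{u \<in> N. p u \<noteq> q u} = sym_diff {u \<in> N. p u} {u \<in> N. q u}" by auto
  then show ?thesis using odd_card_sym_diff[of "{u \<in> N. p u}" "{u \<in> N. q u}"] assms by simp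
qed

lemma card_Collect_bij_betw:
  assumes "bij_betw f N N"
  shows "card {u \<in> N. p (f u)} = card {u \<in> N. p u}"
proof (rule bij_betw_same_card)
  show "bij_betw f {u \<in> N. p (f u)} {u \<in> N. p u}"
    using assms unfolding bij_betw_def inj_on_def by (auto simp: image_iff)
qed

text \<open>Counting by fibres of equal size. It serves for darts over faces (four each), darts over
  edges (two each) and cosets of the kernel of a linear map.\<close>

lemma card_eq_card_image_mult:
  assumes "finite A" "\<And>x. x \<in> A \<Longrightarrow> card {y \<in> A. f y = f x} = k"
  shows "card A = card (f ` A) * k"
proof -
  have "(\<Sum>x\<in>A. 1::nat) = (\<Sum>y\<in>f ` A. card {x \<in> A. f x = y} * 1)"
    using sum_fun_comp[OF assms(1) finite_imageI[OF assms(1), of f] order_refl, of "\<lambda>_. 1::nat"]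
    by simp
  also have "\<dots> = (\<Sum>y\<in>f ` A. k)" using assms(2) by (intro sum.cong) auto
  finally show ?thesis by simp
qed

text \<open>Vector spaces over the two-element field are represented by families of sets, with symmetric
  difference as addition.\<close>

lemma card_linear_image_kernel:
  assumes fin: "finite Q"
    and cl: "\<And>S T. S \<in> Q \<Longrightarrow> T \<in> Q \<Longrightarrow> sym_diff S T \<in> Q"
    and lin: "\<And>S T. S \<in> Q \<Longrightarrow> T \<in> Q \<Longrightarrow> L (sym_diff S T) = sym_diff (L S) (L T)"
  shows "card Q = card (L ` Q) * card {S \<in> Q. L S = {}}"
proof (rule card_eq_card_image_mult[OF fin])
  fix T assume T: "T \<in> Q"
  have inv: "sym_diff (sym_diff S T) T = S" for S :: "'a set" by auto
  \<comment> \<open>Adding \<open>T\<close> is an involution; it exchanges the fibre over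
    \<open>L T\<close> with the kernel.\<close>
  have "bij_betw (\<lambda>S. sym_diff S T) {S \<in> Q. L S = L T} {S \<in> Q. L S = {}}"
  proof (rule bij_betw_byWitness[where f' = "\<lambda>S. sym_diff S T"])
    show "(\<lambda>S. sym_diff S T) ` {S \<in> Q. L S = L T} \<subseteq> {S \<in> Q. L S = {}}"
      using cl T lin by (auto simp: image_subset_iff)
    show "(\<lambda>S. sym_diff S T) ` {S \<in> Q. L S = {}} \<subseteq> {S \<in> Q. L S = L T}"
      using cl T lin by (auto simp: image_subset_iff)
  qed (use inv in auto)
  then show "card {S \<in> Q. L S = L T} = card {S \<in> Q. L S = {}}" by (rule bij_betw_same_card)
qed

text \<open>Rado's proof: if some set has two elements, one of them can be discarded without
  violating Hall's condition.\<close>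

theorem Hall_marriage:
  fixes A :: "'i \<Rightarrow> 'a set"
  assumes "finite I" "\<And>i. i \<in> I \<Longrightarrow> finite (A i)"
    and "\<And>J. J \<subseteq> I \<Longrightarrow> card J \<le> card (\<Union>(A ` J))"
  shows "\<exists>g. inj_on g I \<and> (\<forall>i\<in>I. g i \<in> A i)"
  using assms
proof (induction "\<Sum>i\<in>I. card (A i)" arbitrary: A rule: less_induct)
  case less
  note finI = less.prems(1) and finA = less.prems(2) and hall = less.prems(3)
  have ne: "A i \<noteq> {}" if "i \<in> I" for i using hall[of "{i}"] that by auto
  show ?case
  proof (cases "\<forall>i\<in>I. card (A i) \<le> 1")
    case True
    have "\<exists>x. A i = {x}" if "i \<in> I" for i
    proof -
      have "card (A i) = 1" using True that finA ne by (simp add: card_gt_0_iff le_antisym Suc_le_eq)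
      then show ?thesis by (simp add: card_1_singleton_iff)
    qed
    then obtain g where g: "\<And>i. i \<in> I \<Longrightarrow> A i = {g i}" by metis
    have "\<Union>(A ` I) = g ` I" using g by auto
    then have "card I \<le> card (g ` I)" using hall[of I] by simp
    then have "inj_on g I" using finI by (intro eq_card_imp_inj_on) (auto intro: card_image_le le_antisym)
    then show ?thesis using g by auto
  next
    case False
    then obtain i where i: "i \<in> I" "\<not> card (A i) \<le> 1" by blast
    then obtain x y where xy: "x \<in> A i" "y \<in> A i" "x \<noteq> y"
      using card_le_Suc0_iff_eq[OF finA[OF i(1)]] by auto
    \<comment> \<open>Discarding \<open>z\<close> lowers the total size, so the induction hypothesis
      applies as long as Hall's condition survives.\<close>
    have red: ?thesis if z: "z \<in> A i"
      and H: "\<And>J. J \<subseteq> I \<Longrightarrow> card J \<le> card (\<Union>((A(i := A i - {z})) ` J))" for z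
    proof -
      have "(\<Sum>j\<in>I. card ((A(i := A i - {z})) j)) < (\<Sum>j\<in>I. card (A j))"
        using finI i(1) z finA card_Diff1_less[OF finA[OF i(1)] z]
        by (intro sum_strict_mono_ex1) (auto intro!: bexI[of _ i] card_mono)
      from less.hyps[OF this finI _ H] show ?thesis using finA i(1) by (fastforce split: if_splits)
    qed
    show ?thesis
    proof (rule ccontr)
      assume no: "\<not> ?thesis"
      \<comment> \<open>A family violating the condition after the removal must contain
        \<open>i\<close>. Stating the violation for the family without \<open>i\<close> turns the
        strict inequality into a weak one.\<close>
      have bad: "\<exists>J\<subseteq>I - {i}. card (\<Union>(A ` J) \<union> (A i - {z})) \<le> card J" if "z \<in> A i" for z
      proof -
        have "\<not> (\<forall>J\<subseteq>I. card J \<le> card (\<Union>((A(i := A i - {z})) ` J)))"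
          using red[OF that] no by blast
        then obtain J where J: "J \<subseteq> I" "card (\<Union>((A(i := A i - {z})) ` J)) < card J"
          by (auto simp: not_le)
        have "i \<in> J"
        proof (rule ccontr)
          assume "i \<notin> J"
          then have "(A(i := A i - {z})) ` J = A ` J" by (intro image_cong) auto
          then show False using J hall[of J] by simp
        qed
        then have "\<Union>((A(i := A i - {z})) ` J) = \<Union>(A ` (J - {i})) \<union> (A i - {z})"
          by auto
        moreover have "card J = Suc (card (J - {i}))"
          using \<open>i \<in> J\<close> J(1) finI by (metis card_Suc_Diff1 finite_subset)
        ultimately show ?thesis using J by (intro exI[of _ "J - {i}"]) auto
      qed
      obtain J where J: "J \<subseteq> I - {i}" "card (\<Union>(A ` J) \<union> (A i - {x})) \<le> card J"
        using bad xy by blast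
      obtain K where K: "K \<subseteq> I - {i}" "card (\<Union>(A ` K) \<union> (A i - {y})) \<le> card K"
        using bad xy by blast
      let ?B = "\<Union>(A ` J) \<union> (A i - {x})" and ?C = "\<Union>(A ` K) \<union> (A i - {y})"
      have finJK: "finite J" "finite K" using J K finI by (auto intro: finite_subset)
      have finBC: "finite ?B" "finite ?C" using finJK J K finA i(1) by auto
      \<comment> \<open>Submodularity. Since \<open>x\<close> and \<open>y\<close> differ, the union
        regains all of \<open>A i\<close> and covers \<open>insert i (J \<union> K)\<close>, while
        the intersection covers \<open>J \<inter> K\<close>. Hall's condition for both exceeds the
        bound \<open>card J + card K\<close> by one.\<close>
      have "card ?B + card ?C = card (?B \<union> ?C) + card (?B \<inter> ?C)"
        by (rule card_Un_Int[OF finBC])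
      moreover have "?B \<union> ?C = \<Union>(A ` insert i (J \<union> K))" using xy by auto
      moreover have "card (insert i (J \<union> K)) \<le> card (\<Union>(A ` insert i (J \<union> K)))"
        using J K i(1) by (intro hall) auto
      moreover have "card (insert i (J \<union> K)) = Suc (card (J \<union> K))"
        using J K finJK by (subst card_insert_disjoint) auto
      moreover have "card (J \<inter> K) \<le> card (\<Union>(A ` (J \<inter> K)))"
        using J K by (intro hall) auto
      moreover have "card (\<Union>(A ` (J \<inter> K))) \<le> card (?B \<inter> ?C)"
        using finBC by (intro card_mono) auto
      moreover have "card J + card K = card (J \<union> K) + card (J \<inter> K)"
        by (rule card_Un_Int[OF finJK])
      ultimately show False using J(2) K(2) by simp
    qed
  qed
qed

section \<open>Cyclic sequences\<close>

text \<open>The wrap-around step from \<open>n - 1\<close> to \<open>n\<close> is one of the two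
  changes, so a single change, at some \<open>c\<close>, remains inside, and the interval of true
  values has length \<open>Suc c\<close>.\<close>

lemma two_changes_imp_interval:
  fixes f :: "nat \<Rightarrow> bool"
  assumes per: "f n = f 0" and f0: "f 0" and last: "\<not> f (n - 1)" and n: "0 < n"
    and two: "card {j. j < n \<and> f j \<noteq> f (Suc j)} = 2"
  shows "\<exists>k. 0 < k \<and> k < n \<and> (\<forall>j<n. f j \<longleftrightarrow> j < k)"
proof -
  let ?C = "{j. j < n \<and> f j \<noteq> f (Suc j)}"
  have l: "n - 1 \<in> ?C" using per f0 last n by auto
  have "card (?C - {n - 1}) = 1" using two l by simp
  then obtain c where c: "?C - {n - 1} = {c}" by (auto simp: card_1_singleton_iff)
  then have c1: "c \<in> ?C" "c \<noteq> n - 1" by auto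
  have step: "f (Suc j) = f j" if "j < n - 1" "j \<noteq> c" for j
  proof (rule ccontr)
    assume "f (Suc j) \<noteq> f j"
    then have "j \<in> ?C - {n - 1}" using that by auto
    then show False using c that by auto
  qed
  have lo: "f j" if "j \<le> c" for j
    using that
  proof (induction j)
    case (Suc j)
    then have "j < n - 1" using c1 by auto
    then show ?case using step[of j] Suc by auto
  qed (simp add: f0)
  have hi: "\<not> f j" if "c < j" "j < n" for j
    using that
  proof (induction j)
    case (Suc j)
    show ?case
    proof (cases "j = c")
      case True
      then show ?thesis using lo[of c] c1 by auto
    next
      case False
      then show ?thesis using step[of j] Suc by auto
    qed
  qed simp
  have "f j \<longleftrightarrow> j < Suc c" if "j < n" for j
    using lo[of j] hi[of j] that by (cases "j \<le> c") auto
  then show ?thesis using c1 by (intro exI[of _ "Suc c"]) auto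
qed

text \<open>With \<open>m\<close> the least positive period of \<open>a\<close>, the first
  \<open>m\<close> iterates are distinct. By transitivity and reduction mod \<open>m\<close> they
  exhaust \<open>N\<close>, which forces \<open>m = card N\<close>.\<close>

lemma transitive_funpow_bij:
  fixes r :: "'a \<Rightarrow> 'a"
  assumes bij: "bij_betw r N N" and fin: "finite N"
    and trans: "\<And>u w. u \<in> N \<Longrightarrow> w \<in> N \<Longrightarrow> \<exists>k. (r ^^ k) u = w"
    and a: "a \<in> N"
  shows "bij_betw (\<lambda>j. (r ^^ j) a) {..<card N} N" "(r ^^ card N) a = a"
proof -
  have mem: "(r ^^ k) a \<in> N" for k
    by (induction k) (use a bij in \<open>auto simp: bij_betw_def\<close>)
  obtain k where "(r ^^ k) (r a) = a" using trans[of "r a" a] a bij by (auto simp: bij_betw_def)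
  then have ex: "0 < Suc k \<and> (r ^^ Suc k) a = a" by (simp add: funpow_swap1)
  define m where "m = (LEAST m. 0 < m \<and> (r ^^ m) a = a)"
  have m: "0 < m" "(r ^^ m) a = a"
    using LeastI[of "\<lambda>m. 0 < m \<and> (r ^^ m) a = a", OF ex] by (auto simp: m_def)
  have inj_pow: "(r ^^ i) u = (r ^^ i) w \<Longrightarrow> u \<in> N \<Longrightarrow> w \<in> N \<Longrightarrow> u = w" for i u w
    using bij_betw_funpow[OF bij, of i] by (auto simp: bij_betw_def inj_on_def)
  have neq: "(r ^^ i) a \<noteq> (r ^^ j) a" if "i < j" "j < m" for i j
  proof
    assume "(r ^^ i) a = (r ^^ j) a"
    also have "(r ^^ j) a = (r ^^ i) ((r ^^ (j - i)) a)"
      using that by (simp flip: funpow_add comp_apply[of "r ^^ i"])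
    finally have "(r ^^ (j - i)) a = a" using inj_pow[of i a] a mem by metis
    then have "m \<le> j - i" using that unfolding m_def by (intro Least_le) auto
    then show False using that by simp
  qed
  then have inj: "inj_on (\<lambda>j. (r ^^ j) a) {..<m}"
    by (intro linorder_inj_onI) (auto dest: neq)
  have "(\<lambda>j. (r ^^ j) a) ` {..<m} = N"
  proof
    show "N \<subseteq> (\<lambda>j. (r ^^ j) a) ` {..<m}"
    proof
      fix w assume "w \<in> N"
      then obtain k where "(r ^^ k) a = w" using trans a by blast
      then have "(r ^^ (k mod m)) a = w" using funpow_mod_eq[OF m(2)] by simp
      then show "w \<in> (\<lambda>j. (r ^^ j) a) ` {..<m}" using m(1) by (intro image_eqI[of _ _ "k mod m"]) auto
    qed
  qed (use mem in auto)
  then have b: "bij_betw (\<lambda>j. (r ^^ j) a) {..<m} N" using inj by (simp add: bij_betw_def)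
  then have "m = card N" using bij_betw_same_card by fastforce
  then show "bij_betw (\<lambda>j. (r ^^ j) a) {..<card N} N" "(r ^^ card N) a = a" using b m by auto
qed

subsection \<open>Quadrangulations\<close>

locale colored_quadrangulation =
  fixes V :: "'v set" and E :: "('v \<times> 'v) set" and rot :: "'v \<Rightarrow> 'v \<Rightarrow> 'v"
    and black :: "'v \<Rightarrow> bool"
  assumes quad: "quadrangulation V E rot"
    and col: "proper_2coloring E black"
begin

abbreviation fn :: "'v \<times> 'v \<Rightarrow> 'v \<times> 'v" where "fn \<equiv> fnext rot"
abbreviation F :: "('v \<times> 'v) set set" where "F \<equiv> faces E rot"

definition edges :: "'v set set" where "edges = (\<lambda>(u, v). {u, v}) ` E"

text \<open>The boundary map on 1-chains mod 2. Edge sets with empty boundary are the even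
  subgraphs, that is, the 1-cycles.\<close>

definition boundary :: "'v set set \<Rightarrow> 'v set" where
  "boundary S = {v. odd (card {e \<in> S. v \<in> e})}"

text \<open>The edges with exactly one side in \<open>P\<close>: the cut of \<open>P\<close> in the
  dual graph, or equally the mod-2 sum of the boundaries of the faces in \<open>P\<close>.\<close>

definition coboundary :: "('v \<times> 'v) set set \<Rightarrow> 'v set set" where
  "coboundary P = (\<lambda>(u, v). {u, v}) ` {(u, v) \<in> E. (face_of rot (u, v) \<in> P) \<noteq> (face_of rot (v, u) \<in> P)}"

lemma finite_V: "finite V"
  and E_V: "E \<subseteq> V \<times> V"
  and symE: "(u, v) \<in> E \<Longrightarrow> (v, u) \<in> E"
  and conn: "u \<in> V \<Longrightarrow> v \<in> V \<Longrightarrow> (u, v) \<in> E\<^sup>*"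
  and card_V: "card V \<ge> 4"
  and euler: "2 * card V + 2 * card F = card E + 4"
  and rot_bij: "v \<in> V \<Longrightarrow> bij_betw (rot v) (nbrs E v) (nbrs E v)"
  and rot_trans: "v \<in> V \<Longrightarrow> u \<in> nbrs E v \<Longrightarrow> w \<in> nbrs E v \<Longrightarrow> \<exists>k. (rot v ^^ k) u = w"
  and fn4: "d \<in> E \<Longrightarrow> fn (fn (fn (fn d))) = d"
  and fn_distinct: "d \<in> E \<Longrightarrow> distinct [snd d, snd (fn d), snd (fn (fn d)), snd (fn (fn (fn d)))]"
  using quad
  unfolding quadrangulation_def plane_map_def simple_graph_def connected_graph_def
    rotation_system_def sym_def
  by (auto simp: numeral_eq_Suc)

lemma finite_E: "finite E"
  using finite_V E_V by (meson finite_SigmaI finite_subset)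

lemma col_neq: "(u, v) \<in> E \<Longrightarrow> black u \<noteq> black v"
  using col unfolding proper_2coloring_def by auto

lemma edge_neq: "(u, v) \<in> E \<Longrightarrow> u \<noteq> v"
  using col_neq by blast

lemma finite_nbrs: "finite (nbrs E v)"
  using finite_V E_V by (auto simp: nbrs_def intro: finite_subset)

lemma nbrs_iff: "u \<in> nbrs E v \<longleftrightarrow> (u, v) \<in> E"
  using symE by (auto simp: nbrs_def)

lemma V_if_edge: "(u, v) \<in> E \<Longrightarrow> u \<in> V" "(u, v) \<in> E \<Longrightarrow> v \<in> V"
  using E_V by auto

lemma fn_pair: "fn (u, v) = (v, rot v u)"
  by (simp add: fnext_def)

lemma rot_nbrs: "(u, v) \<in> E \<Longrightarrow> (v, rot v u) \<in> E"
  using rot_bij[of v] V_if_edge[of u v] by (auto simp: bij_betw_def nbrs_def dest: symE)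

lemma fn_E: "d \<in> E \<Longrightarrow> fn d \<in> E"
  by (cases d) (simp add: fn_pair rot_nbrs)

lemma black_fn: "d \<in> E \<Longrightarrow> black (snd (fn d)) \<longleftrightarrow> \<not> black (snd d)"
  using fn_E[of d] col_neq by (cases d) (auto simp: fn_pair)

lemma face_of_eq:
  assumes "d \<in> E"
  shows "face_of rot d = {d, fn d, fn (fn d), fn (fn (fn d))}"
proof
  have "(fn ^^ k) d \<in> {d, fn d, fn (fn d), fn (fn (fn d))}" for k
    by (induction k) (use fn4[OF assms] in auto)
  then show "face_of rot d \<subseteq> {d, fn d, fn (fn d), fn (fn (fn d))}"
    unfolding face_of_def by blast
  have "(fn ^^ 0) d \<in> face_of rot d" "(fn ^^ 1) d \<in> face_of rot d"
    "(fn ^^ 2) d \<in> face_of rot d" "(fn ^^ 3) d \<in> face_of rot d"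
    unfolding face_of_def by blast+
  then show "{d, fn d, fn (fn d), fn (fn (fn d))} \<subseteq> face_of rot d"
    by (simp add: numeral_eq_Suc)
qed

lemma face_of_fn: "d \<in> E \<Longrightarrow> face_of rot (fn d) = face_of rot d"
  using face_of_eq[of d] face_of_eq[OF fn_E, of d] fn4[of d] by auto

lemma face_of_cong:
  assumes "d \<in> E" "e \<in> face_of rot d"
  shows "e \<in> E" "face_of rot e = face_of rot d"
proof -
  have "e \<in> {d, fn d, fn (fn d), fn (fn (fn d))}" using assms face_of_eq by blast
  then show "e \<in> E" "face_of rot e = face_of rot d"
    using assms(1) by (auto simp: fn_E face_of_fn)
qed

lemma self_face: "d \<in> E \<Longrightarrow> d \<in> face_of rot d"
  by (simp add: face_of_eq)

lemma finite_F: "finite F"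
  using finite_E by (simp add: faces_def)

lemma face_of_F: "d \<in> E \<Longrightarrow> face_of rot d \<in> F"
  by (simp add: faces_def)

lemma card_E_faces: "card E = 4 * card F"
proof -
  have "card {y \<in> E. face_of rot y = face_of rot d} = 4" if d: "d \<in> E" for d
  proof -
    have "{y \<in> E. face_of rot y = face_of rot d} = {d, fn d, fn (fn d), fn (fn (fn d))}"
      using face_of_cong[OF d] self_face face_of_eq[OF d] by blast
    moreover have "distinct [d, fn d, fn (fn d), fn (fn (fn d))]"
      using fn_distinct[OF d] by auto
    ultimately show ?thesis using distinct_card by fastforce
  qed
  from card_eq_card_image_mult[OF finite_E this] show ?thesis by (simp add: faces_def)
qed

lemma card_E_edges: "card E = 2 * card edges"
proof -
  have "card {y \<in> E. (\<lambda>(u, v). {u, v}) y = (\<lambda>(u, v). {u, v}) d} = 2" if "d \<in> E" for d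
  proof (cases d)
    case (Pair u v)
    then have "{y \<in> E. (\<lambda>(u, v). {u, v}) y = (\<lambda>(u, v). {u, v}) d} = {(u, v), (v, u)}"
      using that symE by (auto simp: doubleton_eq_iff)
    then show ?thesis using that edge_neq[of u v] Pair by (auto simp: card_insert_if)
  qed
  from card_eq_card_image_mult[OF finite_E this] show ?thesis by (simp add: edges_def)
qed

text \<open>Each dart lies on one face and each face has four darts, so there are twice as many
  edges as faces, and Euler's formula gives the count. The equality later makes the assignment of
  edges to vertices perfect.\<close>

lemma card_edges: "card edges + 4 = 2 * card V"
  using euler card_E_faces card_E_edges by linarith

lemma card_edges_F: "card V + card F = card edges + 2"
  using euler card_E_edges by linarith

lemma finite_edges: "finite edges" using finite_E by (simp add: edges_def)

lemma edgesE: "e \<in> edges \<Longrightarrow> (\<And>u v. (u, v) \<in> E \<Longrightarrow> e = {u, v} \<Longrightarrow> thesis) \<Longrightarrow> thesis"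
  by (auto simp: edges_def)

lemma edges_iff: "{u, v} \<in> edges \<longleftrightarrow> (u, v) \<in> E"
  using symE by (fastforce simp: edges_def doubleton_eq_iff)

subsection \<open>Homology mod 2\<close>

lemma coboundary_iff:
  "{u, v} \<in> coboundary P \<longleftrightarrow> (u, v) \<in> E \<and> (face_of rot (u, v) \<in> P) \<noteq> (face_of rot (v, u) \<in> P)"
  using symE by (fastforce simp: coboundary_def doubleton_eq_iff)

lemma coboundary_edges: "coboundary P \<subseteq> edges"
  by (auto simp: coboundary_def edges_def)

lemma coboundary_linear: "coboundary (sym_diff P Q) = sym_diff (coboundary P) (coboundary Q)"
proof -
  have "{u, v} \<in> coboundary (sym_diff P Q) \<longleftrightarrow> {u, v} \<in> sym_diff (coboundary P) (coboundary Q)" for u v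
    by (auto simp: coboundary_iff)
  moreover have "coboundary (sym_diff P Q) \<subseteq> edges" "sym_diff (coboundary P) (coboundary Q) \<subseteq> edges"
    using coboundary_edges by auto
  moreover have "S = T" if "\<And>u v. {u, v} \<in> S \<longleftrightarrow> {u, v} \<in> T" "S \<subseteq> edges" "T \<subseteq> edges" for S T
  proof (intro set_eqI iffI)
    fix e
    show "e \<in> T" if "e \<in> S"
      using edgesE[of e] that \<open>S \<subseteq> edges\<close> \<open>\<And>u v. {u, v} \<in> S \<longleftrightarrow> {u, v} \<in> T\<close> by (metis subsetD)
    show "e \<in> S" if "e \<in> T"
      using edgesE[of e] that \<open>T \<subseteq> edges\<close> \<open>\<And>u v. {u, v} \<in> S \<longleftrightarrow> {u, v} \<in> T\<close> by (metis subsetD)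
  qed
  ultimately show ?thesis by blast
qed

lemma boundary_linear:
  assumes "S \<subseteq> edges" "T \<subseteq> edges"
  shows "boundary (sym_diff S T) = sym_diff (boundary S) (boundary T)"
proof -
  have "{e \<in> sym_diff S T. v \<in> e} = sym_diff {e \<in> S. v \<in> e} {e \<in> T. v \<in> e}" for v by auto
  moreover have "finite {e \<in> S. v \<in> e}" "finite {e \<in> T. v \<in> e}" for v
    using assms finite_edges by (auto intro: finite_subset)
  ultimately show ?thesis by (auto simp: boundary_def odd_card_sym_diff)
qed

lemma card_edges_at:
  assumes "S \<subseteq> edges"
  shows "card {e \<in> S. v \<in> e} = card {u \<in> nbrs E v. {u, v} \<in> S}"
proof (rule bij_betw_same_card[symmetric], rule bij_betw_imageI)
  show "inj_on (\<lambda>u. {u, v}) {u \<in> nbrs E v. {u, v} \<in> S}"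
    by (auto simp: inj_on_def doubleton_eq_iff)
  show "(\<lambda>u. {u, v}) ` {u \<in> nbrs E v. {u, v} \<in> S} = {e \<in> S. v \<in> e}"
  proof
    show "{e \<in> S. v \<in> e} \<subseteq> (\<lambda>u. {u, v}) ` {u \<in> nbrs E v. {u, v} \<in> S}"
    proof
      fix e assume e: "e \<in> {e \<in> S. v \<in> e}"
      then obtain a b where ab: "(a, b) \<in> E" "e = {a, b}" using assms edgesE by blast
      define u where "u = (if v = a then b else a)"
      have "(u, v) \<in> E" "e = {u, v}" using ab e symE by (auto simp: u_def)
      then show "e \<in> (\<lambda>u. {u, v}) ` {u \<in> nbrs E v. {u, v} \<in> S}"
        using e by (auto simp: nbrs_iff)
    qed
  qed auto
qed

text \<open>A cyclic sequence changes an even number of times: \<open>q\<close> is \<open>p\<close>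
  shifted by the permutation \<open>rot v\<close>, so both hold equally often, and the parity of
  their disagreements is the sum of two equal parities.\<close>

lemma even_card_rot_shift:
  fixes p q :: "'v \<Rightarrow> bool"
  assumes "v \<in> V" "\<And>u. (u, v) \<in> E \<Longrightarrow> q (rot v u) = p u"
  shows "even (card {u \<in> nbrs E v. p u \<noteq> q u})"
proof -
  have "card {u \<in> nbrs E v. q (rot v u)} = card {u \<in> nbrs E v. q u}"
    by (rule card_Collect_bij_betw[OF rot_bij[OF assms(1)]])
  moreover have "{u \<in> nbrs E v. q (rot v u)} = {u \<in> nbrs E v. p u}"
    using assms(2) by (auto simp: nbrs_iff)
  ultimately show ?thesis using odd_card_Collect_neq[OF finite_nbrs, of v p q] by simp
qed

lemma boundary_subset: "S \<subseteq> edges \<Longrightarrow> boundary S \<subseteq> \<Union>S"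
  by (auto simp: boundary_def) (metis (mono_tags, lifting) card.empty empty_Collect_eq even_zero)

lemma edges_V: "\<Union>edges \<subseteq> V"
  using E_V by (auto simp: edges_def)

text \<open>In one turn around a vertex, membership of the current face in \<open>P\<close> changes
  an even number of times. The darts \<open>(u, v)\<close> and \<open>(v, rot v u)\<close> are
  consecutive on a face, which supplies the shift.\<close>

lemma boundary_coboundary: "boundary (coboundary P) = {}"
proof -
  have "even (card {e \<in> coboundary P. v \<in> e})" if v: "v \<in> V" for v
  proof -
    have "{u \<in> nbrs E v. {u, v} \<in> coboundary P} =
        {u \<in> nbrs E v. (face_of rot (u, v) \<in> P) \<noteq> (face_of rot (v, u) \<in> P)}"
      by (auto simp: coboundary_iff nbrs_iff)
    moreover have "even (card \<dots>)"
      using v by (intro even_card_rot_shift) (auto simp: face_of_fn fn_pair[symmetric])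
    ultimately show ?thesis by (simp add: card_edges_at[OF coboundary_edges])
  qed
  moreover have "boundary (coboundary P) \<subseteq> V" using boundary_subset[OF coboundary_edges] edges_V coboundary_edges by blast
  ultimately show ?thesis by (auto simp: boundary_def)
qed

text \<open>If no edge separates \<open>P\<close> from its complement, all faces around a vertex
  agree on membership in \<open>P\<close>, and so do those around adjacent vertices. Connectedness
  spreads this to all faces.\<close>

lemma coboundary_eq_empty_iff:
  assumes "P \<subseteq> F"
  shows "coboundary P = {} \<longleftrightarrow> P = {} \<or> P = F"
proof
  assume 0: "coboundary P = {}"
  let ?p = "\<lambda>d. face_of rot d \<in> P"
  have rev: "?p (u, v) = ?p (v, u)" if "(u, v) \<in> E" for u v
    using 0 coboundary_iff[of u v P] that by auto
  have r1: "(rot v u, v) \<in> E" "?p (rot v u, v) = ?p (u, v)" if "(u, v) \<in> E" for u v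
    using rot_nbrs[OF that] symE face_of_fn[OF that] rev[of v "rot v u"] by (auto simp: fn_pair)
  have rk: "((rot v ^^ k) u, v) \<in> E \<and> ?p ((rot v ^^ k) u, v) = ?p (u, v)"
    if "(u, v) \<in> E" for u v k
    by (induction k) (use that r1 in auto)
  have at: "?p (u, v) = ?p (w, v)" if "(u, v) \<in> E" "(w, v) \<in> E" for u v w
    using rot_trans[of v u w] rk[OF that(1)] that V_if_edge by (auto simp: nbrs_iff)
  have all: "?p (c, b) = ?p (a, r)" if "(r, b) \<in> E\<^sup>*" "(a, r) \<in> E" "(c, b) \<in> E" for a b c r
    using that
  proof (induction arbitrary: c rule: rtrancl_induct)
    case base
    then show ?case using at by blast
  next
    case (step y z)
    have "?p (c, z) = ?p (y, z)" using at step by blast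
    also have "\<dots> = ?p (z, y)" using rev step by blast
    also have "\<dots> = ?p (a, r)" using step symE by blast
    finally show ?case .
  qed
  have "?p d = ?p d'" if "d \<in> E" "d' \<in> E" for d d'
    using all[of "snd d'" "snd d" "fst d'" "fst d"] that conn V_if_edge(2)
    by (cases d; cases d') auto
  then have const: "f \<in> P \<longleftrightarrow> g \<in> P" if "f \<in> F" "g \<in> F" for f g
    using that unfolding faces_def by blast
  show "P = {} \<or> P = F"
  proof (rule disjCI)
    assume "P \<noteq> F"
    then obtain f where "f \<in> F" "f \<notin> P" using assms by blast
    then show "P = {}" using const assms by blast
  qed
next
  show "P = {} \<or> P = F \<Longrightarrow> coboundary P = {}"
    using face_of_F symE by (fastforce simp: coboundary_def)
qed

lemma F_ne: "F \<noteq> {}"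
  using card_edges card_V card_edges_F by auto

text \<open>The kernel consists of \<open>{}\<close> and \<open>F\<close> only, so the coboundaries
  have dimension \<open>card F - 1\<close>.\<close>

lemma card_coboundary_image: "card (coboundary ` Pow F) * 2 = 2 ^ card F"
proof -
  have "{P \<in> Pow F. coboundary P = {}} = {{}, F}" using coboundary_eq_empty_iff by auto
  moreover have "card {{}, F} = 2" using F_ne by (simp add: card_insert_if)
  moreover have "card (Pow F) = card (coboundary ` Pow F) * card {P \<in> Pow F. coboundary P = {}}"
    by (rule card_linear_image_kernel) (auto simp: finite_F coboundary_linear)
  ultimately show ?thesis using finite_F by (simp add: card_Pow)
qed

lemma boundary_empty: "boundary {} = {}" by (simp add: boundary_def)

lemma boundary_edge: "(u, v) \<in> E \<Longrightarrow> boundary {{u, v}} = {u, v}"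
proof -
  have "{e \<in> {{u, v}}. w \<in> e} = (if w \<in> {u, v} then {{u, v}} else {})" for w by auto
  then show ?thesis by (auto simp: boundary_def)
qed

text \<open>Summing the edges of a walk cancels its inner vertices.\<close>

lemma boundary_path:
  assumes "(r, v) \<in> E\<^sup>*"
  shows "\<exists>S\<subseteq>edges. boundary S = sym_diff {r} {v}"
  using assms
proof (induction rule: rtrancl_induct)
  case base
  then show ?case using boundary_empty by auto
next
  case (step y z)
  then obtain S where S: "S \<subseteq> edges" "boundary S = sym_diff {r} {y}" by blast
  have e: "{{y, z}} \<subseteq> edges" using step edges_iff by auto
  have "boundary (sym_diff S {{y, z}}) = sym_diff {r} {z}"
    unfolding boundary_linear[OF S(1) e] S(2) boundary_edge[OF step(2)] using edge_neq[OF step(2)] by auto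
  then show ?case using S e by (intro exI[of _ "sym_diff S {{y, z}}"]) auto
qed

text \<open>Fix a root \<open>r\<close>. Sums of paths from \<open>r\<close> realize every set of
  other vertices as a boundary up to \<open>r\<close> itself, so the boundary map has rank at least
  \<open>card V - 1\<close>.\<close>

lemma card_boundary_image_ge: "2 ^ (card V - 1) \<le> card (boundary ` Pow edges)"
proof -
  obtain r where r: "r \<in> V" using card_V by fastforce
  have "\<exists>S\<subseteq>edges. boundary S - {r} = W" if "W \<subseteq> V - {r}" for W
  proof -
    have "finite W" using that finite_V finite_subset by blast
    then show ?thesis using that
    proof (induction W)
      case empty
      then show ?case using boundary_empty by auto
    next
      case (insert w W)
      then obtain S where S: "S \<subseteq> edges" "boundary S - {r} = W" by auto
      obtain T where T: "T \<subseteq> edges" "boundary T = sym_diff {r} {w}"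
        using boundary_path[OF conn[OF r, of w]] insert.prems by auto
      have "boundary (sym_diff S T) - {r} = insert w W"
        unfolding boundary_linear[OF S(1) T(1)] T(2) using S(2) insert.hyps insert.prems by auto
      then show ?case using S T by (intro exI[of _ "sym_diff S T"]) auto
    qed
  qed
  then have "Pow (V - {r}) \<subseteq> (\<lambda>A. A - {r}) ` boundary ` Pow edges"
    by (intro subsetI) (metis PowD PowI image_eqI)
  then have "card (Pow (V - {r})) \<le> card ((\<lambda>A. A - {r}) ` boundary ` Pow edges)"
    using finite_edges by (intro card_mono) auto
  also have "\<dots> \<le> card (boundary ` Pow edges)" using finite_edges by (intro card_image_le) auto
  finally show ?thesis using r finite_V by (simp add: card_Pow)
qed

text \<open>The first mod-2 cohomology of the sphere vanishes: Euler's formula forces the two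
  spaces to have the same finite dimension.\<close>

lemma cycle_is_coboundary:
  assumes "S \<subseteq> edges" "boundary S = {}"
  shows "\<exists>P\<subseteq>F. coboundary P = S"
proof -
  let ?Z = "{S \<in> Pow edges. boundary S = {}}"
  \<comment> \<open>Rank and nullity: the cycle space has dimension at most
    \<open>card edges - (card V - 1)\<close>.\<close>
  have "card (Pow edges) = card (boundary ` Pow edges) * card ?Z"
    by (rule card_linear_image_kernel) (auto simp: finite_edges boundary_linear)
  then have "2 ^ (card V - 1) * card ?Z \<le> 2 ^ card edges"
    using mult_le_mono1[OF card_boundary_image_ge, of "card ?Z"] finite_edges by (simp add: card_Pow)
  \<comment> \<open>The dimension \<open>card F - 1\<close> of the coboundaries equals this bound by
    Euler's formula. That \<open>V\<close> is nonempty keeps the truncated subtraction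
    exact.\<close>
  moreover have "2 ^ (card V - 1) * card (coboundary ` Pow F) = 2 ^ card edges"
  proof -
    have "2 ^ (card V - 1) * card (coboundary ` Pow F) * 2 = 2 ^ (card V - 1) * 2 ^ card F"
      using card_coboundary_image by (simp add: mult.assoc)
    also have "\<dots> = 2 ^ (card edges + 1)"
      unfolding power_add[symmetric] using card_edges_F card_V
      by (intro arg_cong[where f = "\<lambda>n. 2 ^ n"]) linarith
    finally show ?thesis by simp
  qed
  ultimately have "2 ^ (card V - 1) * card ?Z \<le> 2 ^ (card V - 1) * card (coboundary ` Pow F)"
    by linarith
  then have "card ?Z \<le> card (coboundary ` Pow F)" by simp
  moreover have "coboundary ` Pow F \<subseteq> ?Z" using boundary_coboundary coboundary_edges by auto
  ultimately have "coboundary ` Pow F = ?Z" using finite_edges by (intro card_seteq) auto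
  moreover have "S \<in> ?Z" using assms by blast
  ultimately have "S \<in> coboundary ` Pow F" by simp
  then show ?thesis by blast
qed

section \<open>Even subgraphs\<close>

text \<open>Handshaking: each edge adds a boundary of two vertices, and symmetric difference
  respects parity.\<close>

lemma even_card_boundary:
  assumes "S \<subseteq> edges"
  shows "even (card (boundary S))"
proof -
  have fin: "finite (boundary T)" if "T \<subseteq> edges" for T
    using boundary_subset[OF that] edges_V that finite_V by (meson Union_mono finite_subset)
  have "finite S" using assms finite_edges finite_subset by blast
  then show ?thesis using assms
  proof (induction S)
    case empty
    then show ?case by (simp add: boundary_empty)
  next
    case (insert e S)
    then obtain u v where e: "(u, v) \<in> E" "e = {u, v}" using edgesE[of e] by auto
    have S: "S \<subseteq> edges" "{e} \<subseteq> edges" using insert.prems by auto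
    have "insert e S = sym_diff S {e}" using insert.hyps by auto
    then have "boundary (insert e S) = sym_diff (boundary S) (boundary {e})" using boundary_linear[OF S] by simp
    moreover have "card (boundary {e}) = 2" using boundary_edge[OF e(1)] edge_neq[OF e(1)] e(2) by simp
    ultimately show ?case
      using odd_card_sym_diff[OF fin[OF S(1)] fin[OF S(2)]] insert.IH[OF S(1)] by simp
  qed
qed

lemma second_edge_at:
  assumes "S \<subseteq> edges" "boundary S = {}" "{u, v} \<in> S"
  shows "\<exists>w. w \<noteq> u \<and> {w, v} \<in> S"
proof (rule ccontr)
  assume no: "\<not> ?thesis"
  have "(u, v) \<in> E" using assms edges_iff by blast
  then have "{w \<in> nbrs E v. {w, v} \<in> S} = {u}" using no assms(3) by (auto simp: nbrs_iff)
  then have "card {e \<in> S. v \<in> e} = 1" using card_edges_at[OF assms(1), of v] by simp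
  then have "v \<in> boundary S" by (simp add: boundary_def)
  then show False using assms(2) by simp
qed

text \<open>As no degree in \<open>S\<close> is one, an edge \<open>{u, v}\<close> of
  \<open>S\<close> continues at \<open>v\<close> to \<open>u'\<close>, at \<open>u\<close> to
  \<open>v'\<close> and from there to \<open>u''\<close>. The colours and the choices keep the four
  edges distinct, even if \<open>u'' = u'\<close>.\<close>

lemma cycle_card_ge_4:
  assumes S: "S \<subseteq> edges" "boundary S = {}" and ne: "S \<noteq> {}"
  shows "4 \<le> card S"
proof -
  obtain u v where uv: "{u, v} \<in> S" using ne S edgesE by blast
  obtain u' where u': "u' \<noteq> u" "{u', v} \<in> S" using second_edge_at[OF S uv] by blast
  have vu: "{v, u} \<in> S" using uv by (simp add: insert_commute)
  obtain v' where v': "v' \<noteq> v" "{v', u} \<in> S" using second_edge_at[OF S vu] by blast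
  have uv': "{u, v'} \<in> S" using v' by (simp add: insert_commute)
  obtain u'' where u'': "u'' \<noteq> u" "{u'', v'} \<in> S" using second_edge_at[OF S uv'] by blast
  have c: "black x \<noteq> black y" if "{x, y} \<in> S" for x y
    using that S edges_iff col_neq by blast
  have "u \<noteq> v'" "u' \<noteq> v'" "v \<noteq> u" "v \<noteq> u''" "v \<noteq> u'"
    using c[OF uv] c[OF uv'] c[OF u'(2)] c[OF u''(2)] by auto
  then have "card {{u, v}, {u', v}, {u, v'}, {u'', v'}} = 4"
    using u' v' u'' by (auto simp: card_insert_if doubleton_eq_iff)
  moreover have "{{u, v}, {u', v}, {u, v'}, {u'', v'}} \<subseteq> S" using uv u' uv' u'' by auto
  moreover have "finite S" using S finite_edges finite_subset by blast
  ultimately show ?thesis using card_mono by metis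
qed

subsection \<open>Induced subgraphs\<close>

definition induced :: "'v set \<Rightarrow> 'v set set" where "induced X = {e \<in> edges. e \<subseteq> X}"

lemma induced_edges: "induced X \<subseteq> edges"
  by (auto simp: induced_def)

lemma finite_induced: "finite (induced X)"
  using induced_edges finite_edges finite_subset by blast

text \<open>Boundaries have even size, hence are determined by their elements other than a fixed
  \<open>r\<close>. The subgraph may be disconnected, so only an upper bound on the rank holds in
  general.\<close>

lemma card_boundary_image_induced_le:
  assumes X: "X \<subseteq> V" "X \<noteq> {}"
  shows "card (boundary ` Pow (induced X)) \<le> 2 ^ (card X - 1)"
proof -
  obtain r where r: "r \<in> X" using X by blast
  have finX: "finite X" using X finite_V finite_subset by blast
  have sub: "boundary S \<subseteq> X" if "S \<subseteq> induced X" for S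
    using boundary_subset[of S] that induced_edges by (force simp: induced_def)
  have "inj_on (\<lambda>W. W - {r}) (boundary ` Pow (induced X))"
  proof (rule inj_onI)
    fix W W' assume W: "W \<in> boundary ` Pow (induced X)" "W' \<in> boundary ` Pow (induced X)"
      and eq: "W - {r} = W' - {r}"
    have "even (card T) \<and> finite T" if T: "T \<in> boundary ` Pow (induced X)" for T
    proof -
      obtain S where S: "S \<subseteq> induced X" "T = boundary S" using T by blast
      then have "even (card T)" using even_card_boundary[of S] induced_edges by blast
      moreover have "finite T" using sub[OF S(1)] finX S(2) finite_subset by blast
      ultimately show ?thesis by blast
    qed
    then have ev: "even (card W)" "even (card W')" and fin: "finite W" "finite W'"
      using W by blast+
    have "r \<in> W \<longleftrightarrow> odd (card (W - {r}))" "r \<in> W' \<longleftrightarrow> odd (card (W' - {r}))"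
      using ev fin by (auto simp: card_Diff_singleton_if card_gt_0_iff)
    then have "r \<in> W \<longleftrightarrow> r \<in> W'" unfolding eq by blast
    moreover have "T = (if r \<in> T then insert r (T - {r}) else T - {r})" for T by auto
    ultimately show "W = W'" by (metis eq)
  qed
  then have "card (boundary ` Pow (induced X)) = card ((\<lambda>W. W - {r}) ` boundary ` Pow (induced X))"
    by (simp add: card_image)
  also have "\<dots> \<le> card (Pow (X - {r}))" using sub finX by (intro card_mono) auto
  finally show ?thesis using r finX by (simp add: card_Pow)
qed

text \<open>The faces of the subgraph induced on X: classes of faces of the quadrangulation that can
  be reached from each other by crossing only edges outside of the subgraph.\<close>

definition cross :: "'v set \<Rightarrow> ('v \<times> 'v) set rel" where
  "cross X = {(face_of rot (u, v), face_of rot (v, u)) | u v. (u, v) \<in> E \<and> {u, v} \<notin> induced X}"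

definition merged :: "'v set \<Rightarrow> ('v \<times> 'v) set \<Rightarrow> ('v \<times> 'v) set set" where
  "merged X f = (cross X)\<^sup>* `` {f}"

lemma sym_cross: "sym (cross X)"
  unfolding sym_def cross_def using symE by (fastforce simp: insert_commute)

lemma merged_eq: "g \<in> merged X f \<Longrightarrow> merged X g = merged X f"
  using sym_rtrancl[OF sym_cross, of X]
  by (auto simp: merged_def sym_def) (meson rtrancl_trans)+

lemma merged_self: "f \<in> merged X f"
  by (simp add: merged_def)

lemma merged_F: "f \<in> F \<Longrightarrow> merged X f \<subseteq> F"
proof
  fix g assume f: "f \<in> F" and "g \<in> merged X f"
  then have "(f, g) \<in> (cross X)\<^sup>*" by (simp add: merged_def)
  then show "g \<in> F" by (induction rule: rtrancl_induct) (auto simp: f cross_def face_of_F symE)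
qed

lemma merged_cross:
  assumes "(u, v) \<in> E" "{u, v} \<notin> induced X"
  shows "merged X (face_of rot (v, u)) = merged X (face_of rot (u, v))"
proof (rule merged_eq)
  show "face_of rot (v, u) \<in> merged X (face_of rot (u, v))"
    using assms by (auto simp: merged_def cross_def)
qed

lemma coboundary_merged: "coboundary (merged X f) \<subseteq> induced X"
proof
  fix e assume e: "e \<in> coboundary (merged X f)"
  then obtain u v where uv: "(u, v) \<in> E" "e = {u, v}" using coboundary_edges edgesE by blast
  show "e \<in> induced X"
  proof (rule ccontr)
    assume "e \<notin> induced X"
    then have "merged X (face_of rot (v, u)) = merged X (face_of rot (u, v))"
      using merged_cross uv by blast
    then have "face_of rot (u, v) \<in> merged X f \<longleftrightarrow> face_of rot (v, u) \<in> merged X f"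
      using merged_eq merged_self by metis
    then show False using e uv coboundary_iff by blast
  qed
qed

text \<open>A step of \<open>cross X\<close> crosses an edge outside the subgraph, which cannot
  leave \<open>P\<close>. So the sets of faces bounded inside the subgraph are unions of
  classes.\<close>

lemma merged_subset:
  assumes "coboundary P \<subseteq> induced X" "f \<in> P"
  shows "merged X f \<subseteq> P"
proof
  fix g assume "g \<in> merged X f"
  then have "(f, g) \<in> (cross X)\<^sup>*" by (simp add: merged_def)
  then show "g \<in> P"
  proof (induction rule: rtrancl_induct)
    case (step y z)
    then obtain u v where "(u, v) \<in> E" "{u, v} \<notin> induced X"
      "y = face_of rot (u, v)" "z = face_of rot (v, u)" by (auto simp: cross_def)
    then show ?case using step assms(1) coboundary_iff[of u v P] by blast
  qed (rule assms(2))
qed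

text \<open>Euler's inequality for the induced subgraph. The rank of the boundary map is at most
  \<open>card X - 1\<close>; every cycle is the coboundary of exactly two sets of faces, and these
  are unions of classes, so the nullity is at most the number of classes minus one.\<close>

lemma card_induced_le_merged:
  assumes X: "X \<subseteq> V" "X \<noteq> {}"
  shows "card (induced X) + 2 \<le> card X + card (merged X ` F)"
proof -
  let ?C = "merged X ` F"
  define Q where "Q = {P \<in> Pow F. coboundary P \<subseteq> induced X}"
  define Z where "Z = {S \<in> Pow (induced X). boundary S = {}}"
  have finQ: "finite Q" using finite_F by (simp add: Q_def)
  have 1: "2 ^ card (induced X) = card (boundary ` Pow (induced X)) * card Z"
    using card_linear_image_kernel[of "Pow (induced X)" boundary] finite_induced[of X] induced_edges[of X]
    by (subst card_Pow[symmetric]) (auto simp: boundary_linear Z_def)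
  have "Z \<subseteq> coboundary ` Q"
  proof
    fix S assume "S \<in> Z"
    moreover from this obtain P where "P \<subseteq> F" "coboundary P = S"
      using cycle_is_coboundary[of S] induced_edges by (auto simp: Z_def)
    ultimately show "S \<in> coboundary ` Q" by (auto simp: Q_def Z_def)
  qed
  then have "card Z \<le> card (coboundary ` Q)" using finQ by (intro card_mono) auto
  moreover have "card Q = card (coboundary ` Q) * card {P \<in> Q. coboundary P = {}}"
  proof (rule card_linear_image_kernel[OF finQ])
    show "sym_diff S T \<in> Q" if "S \<in> Q" "T \<in> Q" for S T
      using that by (auto simp: Q_def coboundary_linear)
  qed (rule coboundary_linear)
  moreover have "{P \<in> Q. coboundary P = {}} = {{}, F}"
    using coboundary_eq_empty_iff by (auto simp: Q_def)
  moreover have "card {{}, F} = 2" using F_ne by (simp add: card_insert_if)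
  ultimately have 2: "card Z * 2 \<le> card Q" by simp
  have "card Q \<le> card (Pow ?C)"
  proof (rule card_inj_on_le)
    \<comment> \<open>A set in \<open>Q\<close> is recovered from the classes that it contains,
      which gives the injection.\<close>
    have "P = \<Union>{c \<in> ?C. c \<subseteq> P}" if "P \<in> Q" for P
    proof
      show "P \<subseteq> \<Union>{c \<in> ?C. c \<subseteq> P}"
      proof
        fix f assume "f \<in> P"
        then have "merged X f \<in> {c \<in> ?C. c \<subseteq> P}" using that merged_subset by (auto simp: Q_def)
        then show "f \<in> \<Union>{c \<in> ?C. c \<subseteq> P}" using merged_self by blast
      qed
    qed auto
    then show "inj_on (\<lambda>P. {c \<in> ?C. c \<subseteq> P}) Q" by (metis (no_types, lifting) inj_onI)
    show "(\<lambda>P. {c \<in> ?C. c \<subseteq> P}) ` Q \<subseteq> Pow ?C" by auto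
    show "finite (Pow ?C)" using finite_F by simp
  qed
  then have 3: "card Q \<le> 2 ^ card ?C" using finite_F by (simp add: card_Pow)
  have "2 ^ (card (induced X) + 1) = card (boundary ` Pow (induced X)) * (card Z * 2)"
    using 1 by simp
  also have "\<dots> \<le> 2 ^ (card X - 1) * 2 ^ card ?C"
    using card_boundary_image_induced_le[OF X] 2 3 by (intro mult_le_mono) auto
  finally have "2 ^ (card (induced X) + 1) \<le> (2::nat) ^ (card X - 1 + card ?C)"
    by (simp add: power_add)
  then have "card (induced X) + 1 \<le> card X - 1 + card ?C"
    using power_le_imp_le_exp one_less_numeral_iff semiring_norm(76) by blast
  moreover have "0 < card X" using X finite_V finite_subset by (auto simp: card_gt_0_iff)
  ultimately show ?thesis by linarith
qed

text \<open>Double counting of classes and their border edges. With at least two classes, no class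
  is all of \<open>F\<close>, so its border is a nonempty even subgraph with at least four edges; an
  edge borders at most two classes.\<close>

lemma two_card_merged_le:
  assumes "2 \<le> card (merged X ` F)"
  shows "2 * card (merged X ` F) \<le> card (induced X)"
proof -
  let ?C = "merged X ` F"
  have finC: "finite ?C" using finite_F by simp
  have 4: "4 \<le> card {e \<in> induced X. e \<in> coboundary c}" if c: "c \<in> ?C" for c
  proof -
    have "{e \<in> induced X. e \<in> coboundary c} = coboundary c" using coboundary_merged c by blast
    moreover have "coboundary c \<noteq> {}"
    proof
      assume "coboundary c = {}"
      then have "c = F" using coboundary_eq_empty_iff[of c] merged_F merged_self c by blast
      have "?C \<subseteq> {c}"
      proof
        fix b assume "b \<in> ?C"
        then obtain f where "f \<in> F" "b = merged X f" by blast
        then show "b \<in> {c}" using \<open>c = F\<close> c merged_eq by blast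
      qed
      then have "card ?C \<le> 1" using card_mono[of "{c}" ?C] by simp
      then show False using assms by simp
    qed
    ultimately show ?thesis using cycle_card_ge_4[OF coboundary_edges boundary_coboundary, of c] by simp
  qed
  have 2: "card {c \<in> ?C. e \<in> coboundary c} \<le> 2" if e: "e \<in> induced X" for e
  proof -
    obtain u v where uv: "(u, v) \<in> E" "e = {u, v}" using e induced_edges edgesE by blast
    have "{c \<in> ?C. e \<in> coboundary c} \<subseteq> {merged X (face_of rot (u, v)), merged X (face_of rot (v, u))}"
    proof
      fix c assume c: "c \<in> {c \<in> ?C. e \<in> coboundary c}"
      then obtain f where f: "c = merged X f" by blast
      have "face_of rot (u, v) \<in> c \<or> face_of rot (v, u) \<in> c" using c uv coboundary_iff by blast
      then show "c \<in> {merged X (face_of rot (u, v)), merged X (face_of rot (v, u))}"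
        unfolding f using merged_eq by blast
    qed
    then have "card {c \<in> ?C. e \<in> coboundary c}
        \<le> card {merged X (face_of rot (u, v)), merged X (face_of rot (v, u))}"
      by (intro card_mono) auto
    also have "\<dots> \<le> 2" by (simp add: card_insert_if)
    finally show ?thesis .
  qed
  have "4 * card ?C = (\<Sum>c\<in>?C. 4)" by simp
  also have "\<dots> \<le> (\<Sum>c\<in>?C. card {e \<in> induced X. e \<in> coboundary c})" by (intro sum_mono 4)
  also have "\<dots> = (\<Sum>e\<in>induced X. card {c \<in> ?C. e \<in> coboundary c})"
    by (rule sum_multicount_gen[OF finC finite_induced]) auto
  also have "\<dots> \<le> (\<Sum>e\<in>induced X. 2)" by (intro sum_mono 2)
  finally show ?thesis by simp
qed

text \<open>With two or more classes, their number is eliminated from the two preceding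
  inequalities. With one class there are at most \<open>card X - 1\<close> edges, which suffices
  because \<open>card X\<close> is at least three.\<close>

lemma card_induced_le:
  assumes X: "X \<subseteq> V" "3 \<le> card X"
  shows "card (induced X) + 4 \<le> 2 * card X"
proof -
  have "X \<noteq> {}" using X by auto
  note euler_le = card_induced_le_merged[OF X(1) this]
  show ?thesis
  proof (cases "2 \<le> card (merged X ` F)")
    case True
    then show ?thesis using euler_le two_card_merged_le[OF True] by linarith
  next
    case False
    then show ?thesis using euler_le X(2) by linarith
  qed
qed

subsection \<open>Orientations and labelings\<close>

text \<open>Every vertex other than the two poles claims two of its edges; by the edge count, all edges
  are claimed exactly once. Orienting each edge away from its claimant gives a 2-orientation.\<close>

lemma two_orientation:
  assumes s: "s0 \<in> V" "s1 \<in> V" "s0 \<noteq> s1" "black s0" "black s1"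
  shows "\<exists>out. (\<forall>u v. (u, v) \<in> E \<longrightarrow> out u v \<noteq> out v u) \<and>
    (\<forall>v\<in>V. card {u \<in> nbrs E v. out v u} = (if v \<in> {s0, s1} then 0 else 2))"
proof -
  \<comment> \<open>Two copies of each vertex other than the poles: distinct representatives then
    assign two edges to each such vertex.\<close>
  define I where "I = (V - {s0, s1}) \<times> (UNIV :: bool set)"
  define A where "A = (\<lambda>(v, b :: bool). {e \<in> edges. v \<in> e})"
  have finI: "finite I" using finite_V by (simp add: I_def)
  have cardI: "card I = card edges"
    using s card_edges finite_V by (simp add: I_def card_cartesian_product card_Diff_subset)
  have "\<exists>g. inj_on g I \<and> (\<forall>i\<in>I. g i \<in> A i)"
  proof (rule Hall_marriage[OF finI])
    show "finite (A i)" for i using finite_edges by (auto simp: A_def split: prod.split)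
    fix J assume J: "J \<subseteq> I"
    define Y where "Y = fst ` J"
    have Y: "Y \<subseteq> V - {s0, s1}" using J by (auto simp: Y_def I_def)
    have finY: "finite Y" using Y finite_V finite_subset by blast
    have "J \<subseteq> Y \<times> UNIV" by (force simp: Y_def)
    then have "card J \<le> card (Y \<times> (UNIV :: bool set))" using finY by (intro card_mono) auto
    then have 1: "card J \<le> 2 * card Y" by (simp add: card_cartesian_product)
    \<comment> \<open>The edges meeting \<open>Y\<close> are those not induced on its complement, so
      Hall's condition becomes the upper bound on induced edges.\<close>
    have "\<Union>(A ` J) = edges - induced (V - Y)"
    proof
      show "\<Union>(A ` J) \<subseteq> edges - induced (V - Y)" by (force simp: A_def Y_def induced_def)
      show "edges - induced (V - Y) \<subseteq> \<Union>(A ` J)" using edges_V by (force simp: A_def Y_def induced_def)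
    qed
    then have 2: "card (\<Union>(A ` J)) = card edges - card (induced (V - Y))"
      using finite_induced induced_edges by (simp add: card_Diff_subset)
    have cX: "card (V - Y) + card Y = card V"
    proof -
      have "Y \<subseteq> V" using Y by blast
      then show ?thesis using finY card_mono[OF finite_V, of Y] by (simp add: card_Diff_subset)
    qed
    have "card (induced (V - Y)) + 4 \<le> 2 * card (V - Y)"
    \<comment> \<open>The complement always contains the poles. If it has fewer than three vertices
      it consists of them alone, and two black vertices span no edge.\<close>
    proof (cases "3 \<le> card (V - Y)")
      case False
      have ss: "{s0, s1} \<subseteq> V - Y" using Y s by auto
      moreover have "card {s0, s1} = 2" using s by simp
      ultimately have eq: "V - Y = {s0, s1}" using False finite_V by (metis card_seteq finite_Diff
          not_less_eq_eq numeral_2_eq_2 numeral_3_eq_3)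
      have "induced {s0, s1} = {}"
      proof (rule ccontr)
        assume "induced {s0, s1} \<noteq> {}"
        then obtain e where e: "e \<in> edges" "e \<subseteq> {s0, s1}" by (auto simp: induced_def)
        then obtain u v where "(u, v) \<in> E" "e = {u, v}" using edgesE by blast
        then show False using col_neq[of u v] e s by auto
      qed
      then show ?thesis using eq s by simp
    qed (use card_induced_le in auto)
    then show "card J \<le> card (\<Union>(A ` J))" using 1 2 cX card_edges by linarith
  qed
  then obtain g where g: "inj_on g I" "\<And>v b. (v, b) \<in> I \<Longrightarrow> g (v, b) \<in> edges \<and> v \<in> g (v, b)"
    by (auto simp: A_def)
  \<comment> \<open>\<open>I\<close> has as many elements as there are edges, so the injection
    \<open>g\<close> is onto and every edge has exactly one claimant.\<close>
  have gU: "g ` I = edges"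
    using g finite_edges cardI by (intro card_subset_eq) (auto simp: card_image)
  define out where "out v u \<longleftrightarrow> (\<exists>b. (v, b) \<in> I \<and> g (v, b) = {u, v})" for v u
  have "out u v \<noteq> out v u" if uv: "(u, v) \<in> E" for u v
  proof -
    have "{u, v} \<in> g ` I" using gU uv edges_iff by blast
    then obtain w b where w: "(w, b) \<in> I" "g (w, b) = {u, v}" by auto
    then have "w \<in> {u, v}" using g(2) by blast
    moreover have "out x y \<longleftrightarrow> x = w" if xy: "{y, x} = {u, v}" for x y
    proof
      assume "out x y"
      then obtain c where "(x, c) \<in> I" "g (x, c) = {u, v}" using xy by (auto simp: out_def)
      then show "x = w" using inj_onD[OF g(1), of "(x, c)" "(w, b)"] w by simp
    next
      assume "x = w"
      then show "out x y" using w xy unfolding out_def by blast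
    qed
    ultimately show ?thesis using edge_neq[OF uv] by (metis insert_commute insertE singletonD)
  qed
  moreover have "card {u \<in> nbrs E v. out v u} = 2" if v: "v \<in> V" "v \<notin> {s0, s1}" for v
  proof -
    let ?S = "{g (v, False), g (v, True)}"
    have I: "(v, b) \<in> I" for b using v by (simp add: I_def)
    have "g (v, False) \<noteq> g (v, True)" using inj_onD[OF g(1) _ I I] by blast
    then have "card ?S = 2" by simp
    moreover have "{e \<in> ?S. v \<in> e} = ?S" using g(2)[OF I] by auto
    moreover have "?S \<subseteq> edges" using g(2)[OF I] by auto
    moreover have "{u \<in> nbrs E v. {u, v} \<in> ?S} = {u \<in> nbrs E v. out v u}"
      by (simp add: out_def I ex_bool_eq disj_commute eq_commute)
    ultimately show ?thesis using card_edges_at[of ?S v] by simp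
  qed
  moreover have "card {u \<in> nbrs E v. out v u} = 0" if "v \<in> {s0, s1}" for v
    using that by (auto simp: out_def I_def)
  ultimately show ?thesis by (intro exI[of _ out]) auto
qed

section \<open>Labels from an orientation\<close>

lemma labels_along_faces:
  "\<exists>lab. \<forall>d\<in>E. lab (fn d) = (lab d \<noteq> black (snd d))"
proof -
  have "\<exists>e. e \<in> E \<and> face_of rot e = f \<and> black (snd e)" if f: "f \<in> F" for f
  proof -
    obtain d where d: "d \<in> E" "f = face_of rot d" using f by (auto simp: faces_def)
    then show ?thesis using black_fn[of d] fn_E[of d] face_of_fn[of d] by metis
  qed
  then obtain r where r: "\<And>f. f \<in> F \<Longrightarrow> r f \<in> E \<and> face_of rot (r f) = f \<and> black (snd (r f))"
    by metis
  \<comment> \<open>From a chosen black corner \<open>r f\<close>, the labels along the face are 1,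
    0, 0, 1, with true for 1, so they change exactly after the black corners. Comparing heads
    suffices because the heads on a face are distinct.\<close>
  define lab where "lab d \<longleftrightarrow> snd d = snd (r (face_of rot d)) \<or>
    snd d = snd (fn (fn (fn (r (face_of rot d)))))" for d
  have "lab (fn d) = (lab d \<noteq> black (snd d))" if d: "d \<in> E" for d
  proof -
    define e where "e = r (face_of rot d)"
    have e: "e \<in> E" "face_of rot e = face_of rot d" "black (snd e)"
      using r[OF face_of_F[OF d]] by (auto simp: e_def)
    have "d \<in> {e, fn e, fn (fn e), fn (fn (fn e))}"
      using self_face[OF d] face_of_eq[OF e(1)] e(2) by simp
    moreover have "lab d \<longleftrightarrow> snd d = snd e \<or> snd d = snd (fn (fn (fn e)))"
      "lab (fn d) \<longleftrightarrow> snd (fn d) = snd e \<or> snd (fn d) = snd (fn (fn (fn e)))"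
      by (auto simp: lab_def e_def face_of_fn[OF d])
    moreover have "\<not> black (snd (fn e))" "black (snd (fn (fn e)))" "\<not> black (snd (fn (fn (fn e))))"
      using e black_fn fn_E by auto
    ultimately show ?thesis using fn_distinct[OF e(1)] fn4[OF e(1)] e(3) by auto
  qed
  then show ?thesis by blast
qed

text \<open>Correct an arbitrary labeling with the right behaviour along faces by flipping whole faces.
  The discrepancy across edges is a closed cochain, because all out-degrees are even.\<close>

lemma labels_of_orientation:
  assumes ori: "\<And>u v. (u, v) \<in> E \<Longrightarrow> out u v \<noteq> out v u"
    and even: "\<And>v. v \<in> V \<Longrightarrow> even (card {u \<in> nbrs E v. out v u})"
  shows "\<exists>lab. (\<forall>d\<in>E. lab (fn d) = (lab d \<noteq> black (snd d))) \<and>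
    (\<forall>u v. (u, v) \<in> E \<longrightarrow> (lab (u, v) \<noteq> lab (v, u)) = (out v u \<noteq> black v))"
proof -
  obtain l where l: "\<And>d. d \<in> E \<Longrightarrow> l (fn d) = (l d \<noteq> black (snd d))"
    using labels_along_faces by blast
  \<comment> \<open>The discrepancy between the actual and the required label relation across the
    edge. It does not depend on the direction, since exchanging \<open>u\<close> and
    \<open>v\<close> flips both \<open>out v u\<close> and \<open>black v\<close>.\<close>
  define h where "h u v \<longleftrightarrow> ((l (u, v) \<noteq> l (v, u)) \<noteq> (out v u \<noteq> black v))" for u v
  have h_sym: "h u v = h v u" if "(u, v) \<in> E" for u v
    using ori[OF that] col_neq[OF that] by (auto simp: h_def)
  define S where "S = (\<lambda>(u, v). {u, v}) ` {(u, v) \<in> E. h u v}"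
  have S_iff: "{u, v} \<in> S \<longleftrightarrow> (u, v) \<in> E \<and> h u v" for u v
    using h_sym symE by (auto simp: S_def image_iff doubleton_eq_iff)
  have S_U: "S \<subseteq> edges" by (auto simp: S_def edges_def)
  have "even (card {e \<in> S. v \<in> e})" if v: "v \<in> V" for v
  proof -
    \<comment> \<open>By the rule along faces, \<open>l (v, u) \<noteq> black v\<close> is the label
      at \<open>v\<close> on the other side of the edge. So the degree of \<open>v\<close> in
      \<open>S\<close> is, mod 2, the number of label changes around \<open>v\<close> plus its
      out-degree, and both are even.\<close>
    have "{u \<in> nbrs E v. {u, v} \<in> S} =
        {u \<in> nbrs E v. (l (u, v) \<noteq> (l (v, u) \<noteq> black v)) \<noteq> out v u}"
      by (auto simp: S_iff nbrs_iff h_def)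
    moreover have "even (card {u \<in> nbrs E v. l (u, v) \<noteq> (l (v, u) \<noteq> black v)})"
    proof (rule even_card_rot_shift[OF v])
      show "(l (v, rot v u) \<noteq> black v) = l (u, v)" if "(u, v) \<in> E" for u
        using l[OF that] by (auto simp: fn_pair)
    qed
    ultimately show ?thesis
      using even[OF v] odd_card_Collect_neq[OF finite_nbrs[of v],
          of "\<lambda>u. l (u, v) \<noteq> (l (v, u) \<noteq> black v)" "out v"]
      by (simp add: card_edges_at[OF S_U])
  qed
  then have "boundary S = {}" using boundary_subset[OF S_U] edges_V S_U by (fastforce simp: boundary_def)
  then obtain P where P: "coboundary P = S" using cycle_is_coboundary[OF S_U] by blast
  \<comment> \<open>Flipping all corners of the faces in \<open>P\<close> preserves the rule along
    faces and toggles the relation across exactly the edges in \<open>S\<close>.\<close>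
  define lab where "lab d \<longleftrightarrow> l d \<noteq> (face_of rot d \<in> P)" for d
  have "lab (fn d) = (lab d \<noteq> black (snd d))" if "d \<in> E" for d
    using l[OF that] face_of_fn[OF that] by (auto simp: lab_def)
  moreover have "(lab (u, v) \<noteq> lab (v, u)) = (out v u \<noteq> black v)" if "(u, v) \<in> E" for u v
    using coboundary_iff[of u v P] S_iff[of u v] that unfolding P lab_def h_def by blast
  ultimately show ?thesis by blast
qed

section \<open>Labels around a vertex\<close>

text \<open>The two corners lie at \<open>v\<close> on either side of the edge to
  \<open>rot v w\<close>. A face step and the rule across this edge connect their labels through the
  dart \<open>(v, rot v w)\<close>, and the two occurrences of \<open>black v\<close>
  cancel.\<close>

lemma label_change_rot:
  assumes lab: "\<And>d. d \<in> E \<Longrightarrow> lab (fn d) = (lab d \<noteq> black (snd d))"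
    and edge: "\<And>u v. (u, v) \<in> E \<Longrightarrow> (lab (u, v) \<noteq> lab (v, u)) = (out v u \<noteq> black v)"
    and w: "(w, v) \<in> E"
  shows "lab (rot v w, v) \<noteq> lab (w, v) \<longleftrightarrow> out v (rot v w)"
  using lab[OF w] edge[OF symE[OF rot_nbrs[OF w]]] by (auto simp: fn_pair)

text \<open>One turn around \<open>v\<close> meets exactly two label changes, one per outgoing edge.
  Starting just after a change from 0 to 1 yields first the 1s and then the 0s.\<close>

lemma labels_interval:
  fixes lab :: "'v \<times> 'v \<Rightarrow> bool"
  assumes change: "\<And>w. (w, v) \<in> E \<Longrightarrow> lab (rot v w, v) \<noteq> lab (w, v) \<longleftrightarrow> out v (rot v w)"
    and v: "v \<in> V" and two: "card {u \<in> nbrs E v. out v u} = 2"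
  shows "\<exists>a\<in>nbrs E v. \<exists>k. 0 < k \<and> k < card (nbrs E v) \<and>
    (\<forall>j<card (nbrs E v). lab ((rot v ^^ j) a, v) \<longleftrightarrow> j < k)"
proof -
  let ?N = "nbrs E v" and ?r = "rot v"
  let ?n = "card ?N"
  have rN: "?r w \<in> ?N" if "w \<in> ?N" for w
    using rot_bij[OF v] that by (auto simp: bij_betw_def)
  have "{u \<in> ?N. out v u} \<noteq> {}" using two by force
  then obtain u where u: "u \<in> ?N" "out v u" by blast
  then obtain w0 where w0: "w0 \<in> ?N" "?r w0 = u"
    using rot_bij[OF v] by (metis bij_betw_imp_surj_on imageE)
  \<comment> \<open>Both labels occur at \<open>v\<close>. Without a change from 0 to 1, a 0 would
    persist along the whole rotation.\<close>
  have "\<exists>w\<in>?N. \<not> lab (w, v) \<and> lab (?r w, v)"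
  proof (rule ccontr)
    assume no: "\<not> ?thesis"
    have ch: "lab (u, v) \<noteq> lab (w0, v)" using change[of w0] w0 u by (auto simp: nbrs_iff)
    obtain x y where xy: "x \<in> ?N" "y \<in> ?N" "\<not> lab (x, v)" "lab (y, v)"
      using ch u w0 by blast
    have "(?r ^^ k) x \<in> ?N \<and> \<not> lab ((?r ^^ k) x, v)" for k
      by (induction k) (use no xy rN in auto)
    then show False using rot_trans[OF v xy(1,2)] xy(4) by auto
  qed
  then obtain w where w: "w \<in> ?N" "\<not> lab (w, v)" "lab (?r w, v)" by blast
  define a where "a = ?r w"
  have a: "a \<in> ?N" using rN w by (simp add: a_def)
  have cyc: "bij_betw (\<lambda>j. (?r ^^ j) x) {..<?n} ?N" "(?r ^^ ?n) x = x" if "x \<in> ?N" for x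
    using transitive_funpow_bij[OF rot_bij[OF v] finite_nbrs rot_trans[OF v] that] by auto
  have n: "0 < ?n" using a finite_nbrs by (auto simp: card_gt_0_iff)
  have memN: "(?r ^^ j) a \<in> ?N" for j by (induction j) (use a rN in auto)
  have last: "(?r ^^ (?n - 1)) a = w"
  proof -
    have "(?r ^^ (?n - 1)) a = (?r ^^ Suc (?n - 1)) w" by (simp add: a_def funpow_swap1)
    then show ?thesis using n cyc(2)[OF w(1)] by simp
  qed
  have "bij_betw (?r \<circ> (\<lambda>j. (?r ^^ j) a)) {..<?n} ?N"
    using cyc(1)[OF a] rot_bij[OF v] by (rule bij_betw_trans)
  then have b: "bij_betw (\<lambda>j. (?r ^^ Suc j) a) {..<?n} ?N" by (simp add: comp_def)
  \<comment> \<open>The change after position \<open>j\<close> occurs across the edge to the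
    neighbour at position \<open>Suc j\<close>, hence the shift by one.\<close>
  have "bij_betw (\<lambda>j. (?r ^^ Suc j) a)
      {j. j < ?n \<and> lab ((?r ^^ j) a, v) \<noteq> lab ((?r ^^ Suc j) a, v)} {u \<in> ?N. out v u}"
  proof (rule bij_betw_subset[OF b])
    have *: "lab ((?r ^^ j) a, v) \<noteq> lab ((?r ^^ Suc j) a, v) \<longleftrightarrow> out v ((?r ^^ Suc j) a)" for j
      using change[of "(?r ^^ j) a"] memN[of j] by (auto simp: nbrs_iff)
    show "(\<lambda>j. (?r ^^ Suc j) a) ` {j. j < ?n \<and> lab ((?r ^^ j) a, v) \<noteq> lab ((?r ^^ Suc j) a, v)}
        = {u \<in> ?N. out v u}"
      unfolding *
    proof -
      have "f ` {j. j < k \<and> Q (f j)} = {u \<in> f ` {..<k}. Q u}" for f :: "nat \<Rightarrow> 'v" and k Q by auto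
      from this[of "\<lambda>j. (?r ^^ Suc j) a" ?n "out v"]
      show "(\<lambda>j. (?r ^^ Suc j) a) ` {j. j < ?n \<and> out v ((?r ^^ Suc j) a)} = {u \<in> ?N. out v u}"
        unfolding bij_betw_imp_surj_on[OF b] .
    qed
  qed auto
  from bij_betw_same_card[OF this]
  have "card {j. j < ?n \<and> lab ((?r ^^ j) a, v) \<noteq> lab ((?r ^^ Suc j) a, v)} = 2"
    unfolding two .
  then have "\<exists>k. 0 < k \<and> k < ?n \<and> (\<forall>j<?n. lab ((?r ^^ j) a, v) \<longleftrightarrow> j < k)"
    using w(2,3) last n cyc(2)[OF a]
    by (intro two_changes_imp_interval) (simp_all flip: a_def)
  then show ?thesis using a by blast
qed

lemma labels_at_sink:
  fixes lab :: "'v \<times> 'v \<Rightarrow> bool"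
  assumes change: "\<And>w. (w, v) \<in> E \<Longrightarrow> lab (rot v w, v) \<noteq> lab (w, v) \<longleftrightarrow> out v (rot v w)"
    and v: "v \<in> V" and zero: "card {u \<in> nbrs E v. out v u} = 0"
    and uw: "(u, v) \<in> E" "(w, v) \<in> E"
  shows "lab (u, v) = lab (w, v)"
proof -
  have no: "\<not> out v x" if "(x, v) \<in> E" for x
  proof
    assume "out v x"
    then have "x \<in> {u \<in> nbrs E v. out v u}" using that by (simp add: nbrs_iff)
    moreover have "{u \<in> nbrs E v. out v u} = {}" using zero finite_nbrs[of v] by simp
    ultimately show False by blast
  qed
  have "((rot v ^^ k) u, v) \<in> E \<and> lab ((rot v ^^ k) u, v) = lab (u, v)" for k
  proof (induction k)
    case (Suc k)
    then have "(rot v ((rot v ^^ k) u), v) \<in> E" using rot_nbrs symE by blast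
    then show ?case using Suc change[of "(rot v ^^ k) u"] no by auto
  qed (use uw in simp)
  then show ?thesis using rot_trans[OF v, of u w] uw by (auto simp: nbrs_iff)
qed

theorem strong_labeling_exists:
  assumes out_E: "out \<in> E"
  shows "\<exists>lab. strong_labeling V E rot out black lab"
proof -
  \<comment> \<open>A dart of the outer face with black head. Its head and the opposite corner, two
    steps further, become the poles.\<close>
  define e0 where "e0 = (if black (snd out) then out else fn out)"
  have e0: "e0 \<in> E" "black (snd e0)" "face_of rot e0 = face_of rot out"
    using out_E fn_E[of out] black_fn[of out] face_of_fn[of out] by (auto simp: e0_def)
  define s0 where "s0 = snd e0"
  define s1 where "s1 = snd (fn (fn e0))"
  have s_black: "black s0" "black s1" using e0 black_fn fn_E by (auto simp: s0_def s1_def)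
  have s_neq: "s0 \<noteq> s1" using fn_distinct[OF e0(1)] by (auto simp: s0_def s1_def)
  have s_V: "s0 \<in> V" "s1 \<in> V"
    using e0(1) fn_E V_if_edge(2) unfolding s0_def s1_def by (metis prod.collapse)+
  have s_out: "s0 \<in> snd ` face_of rot out" "s1 \<in> snd ` face_of rot out"
    using face_of_eq[OF e0(1)] by (auto simp: e0(3)[symmetric] s0_def s1_def)
  obtain ori where ori: "\<And>u v. (u, v) \<in> E \<Longrightarrow> ori u v \<noteq> ori v u"
    and deg: "\<And>v. v \<in> V \<Longrightarrow> card {u \<in> nbrs E v. ori v u} = (if v \<in> {s0, s1} then 0 else 2)"
    using two_orientation[OF s_V s_neq s_black] by blast
  have "even (card {u \<in> nbrs E v. ori v u})" if "v \<in> V" for v using deg[OF that] by simp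
  from labels_of_orientation[OF ori this] obtain l
    where l: "\<And>d. d \<in> E \<Longrightarrow> l (fn d) = (l d \<noteq> black (snd d))"
      and l_edge: "\<And>u v. (u, v) \<in> E \<Longrightarrow> (l (u, v) \<noteq> l (v, u)) = (ori v u \<noteq> black v)"
    by blast
  \<comment> \<open>Complementing all labels respects both rules, so the label of the corner
    \<open>e0\<close> at \<open>s0\<close> can be normalized to 0; as \<open>s0\<close> is a sink,
    all its angles follow.\<close>
  define m where "m d \<longleftrightarrow> l d \<noteq> l e0" for d
  have m: "m (fn d) = (m d \<noteq> black (snd d))" if "d \<in> E" for d
    using l[OF that] by (auto simp: m_def)
  have m_edge: "(m (u, v) \<noteq> m (v, u)) = (ori v u \<noteq> black v)" if "(u, v) \<in> E" for u v
    using l_edge[OF that] by (auto simp: m_def)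
  have change: "m (rot v w, v) \<noteq> m (w, v) \<longleftrightarrow> ori v (rot v w)" if "(w, v) \<in> E" for w v
    using label_change_rot[of m ori, OF m m_edge that] by blast
  have sink: "m d = m d'" if "d \<in> E" "d' \<in> E" "snd d = v" "snd d' = v" "v \<in> {s0, s1}" for d d' v
    using labels_at_sink[of v m ori "fst d" "fst d'", OF change] deg[of v] s_V that
    by (cases d; cases d') auto
  have m0: "\<not> m d" if "d \<in> E" "snd d = s0" for d
    using sink[OF that(1) e0(1) that(2)] by (auto simp: m_def s0_def)
  \<comment> \<open>Between the two black corners of the outer face there is exactly one label
    change, namely right after \<open>s0\<close>. This makes the angles at \<open>s1\<close> equal
    to 1.\<close>
  have "m (fn (fn e0))"
    using m[OF e0(1)] m[OF fn_E[OF e0(1)]] e0(2) black_fn[OF e0(1)] by (auto simp: m_def)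
  then have m1: "m d" if "d \<in> E" "snd d = s1" for d
    using sink[OF that(1) fn_E[OF fn_E[OF e0(1)]] that(2)] by (auto simp: s1_def)
  define lab where "lab d = (if m d then 1 else 0 :: nat)" for d
  have G1: "\<exists>a\<in>nbrs E v. \<exists>k. 0 < k \<and> k < card (nbrs E v) \<and>
        (\<forall>j<card (nbrs E v). lab ((rot v ^^ j) a, v) = (if j < k then 1 else 0))"
    if v: "v \<in> V - {s0, s1}" for v
  proof -
    have "card {u \<in> nbrs E v. ori v u} = 2" using deg v by auto
    then obtain a k where "a \<in> nbrs E v" "0 < k" "k < card (nbrs E v)"
      "\<And>j. j < card (nbrs E v) \<Longrightarrow> m ((rot v ^^ j) a, v) \<longleftrightarrow> j < k"
      using labels_interval[of v m ori, OF change] v by blast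
    then show ?thesis by (intro bexI[of _ a] exI[of _ k]) (auto simp: lab_def)
  qed
  have G2: "(lab (u, v) = lab (w, v)) \<longleftrightarrow> (lab (v, u) \<noteq> lab (w', u))"
    if "(u, v) \<in> E" "w \<in> nbrs E v" "w' \<in> nbrs E u" "rot v w = u" "rot u w' = v" for u v w w'
    using change[of w v] change[of w' u] that ori[OF that(1)] by (auto simp: lab_def nbrs_iff)
  have G3: "\<exists>e\<in>face_of rot d. lab e = 0 \<and> lab (fn e) = 0 \<and>
      lab ((fn ^^ 2) e) = 1 \<and> lab ((fn ^^ 3) e) = 1" if d: "d \<in> E" for d
  proof -
    \<comment> \<open>The cyclic pattern 0, 0, 1, 1 must start at a white corner, as labels change
      only after black ones. Opposite white corners have different labels, so one of the two has
      label 0.\<close>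
    define d' where "d' = (if black (snd d) then fn d else d)"
    define e where "e = (if m d' then fn (fn d') else d')"
    have d': "d' \<in> E" "\<not> black (snd d')" "face_of rot d' = face_of rot d"
      using d fn_E[OF d] black_fn[OF d] face_of_fn[OF d] by (auto simp: d'_def)
    have f: "fn d' \<in> E" "fn (fn d') \<in> E" using d' fn_E by auto
    have e: "e \<in> E" "\<not> black (snd e)" "\<not> m e" "face_of rot e = face_of rot d"
      using d' f black_fn[OF d'(1)] black_fn[OF f(1)] face_of_fn[OF d'(1)] face_of_fn[OF f(1)]
        m[OF d'(1)] m[OF f(1)] by (auto simp: e_def)
    have "fn e \<in> E" "fn (fn e) \<in> E" using e fn_E by auto
    then have "\<not> m (fn e)" "m (fn (fn e))" "m (fn (fn (fn e)))"
      using m[of e] m[of "fn e"] m[of "fn (fn e)"] black_fn[of e] black_fn[of "fn e"] e by auto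
    then show ?thesis
      using e self_face[OF e(1)] by (intro bexI[of _ e]) (auto simp: lab_def numeral_eq_Suc)
  qed
  have G3_outer: "lab e = 0 \<and> lab ((fn ^^ 3) e) = 0 \<and> lab ((fn ^^ 2) e) = 1 \<and> lab (fn e) = 1"
    if e: "e \<in> face_of rot out" "snd e = s0" for e
  proof -
    have eE: "e \<in> E" using face_of_cong[OF out_E e(1)] by blast
    then have f: "fn e \<in> E" "fn (fn e) \<in> E" using fn_E by auto
    have "\<not> m e" "black (snd e)" using m0[OF eE e(2)] e(2) s_black by auto
    \<comment> \<open>Along the walk from the black corner at \<open>s0\<close> the labels are 0, 1,
      1, 0; read in the opposite direction from \<open>s0\<close> they are 0, 0, 1, 1.\<close>
    then have "m (fn e)" "m (fn (fn e))" "\<not> m (fn (fn (fn e)))"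
      using m[OF eE] m[OF f(1)] m[OF f(2)] black_fn[OF eE] black_fn[OF f(1)] by auto
    then show ?thesis using \<open>\<not> m e\<close> by (simp add: lab_def numeral_eq_Suc)
  qed
  have "strong_labeling_named V E rot out black s0 s1 lab"
    unfolding strong_labeling_named_def
    using s_neq s_black s_out m0 m1 G1 G2 G3 G3_outer
    by (intro conjI ballI allI impI; (auto simp: lab_def; fail)?) auto
  then show ?thesis unfolding strong_labeling_def by blast
qed

end

theorem theorem12:
  fixes V :: "'v set" and E :: "('v \<times> 'v) set" and rot :: "'v \<Rightarrow> 'v \<Rightarrow> 'v"
    and out :: "'v \<times> 'v" and black :: "'v \<Rightarrow> bool"
  assumes "quadrangulation V E rot"
    and "out \<in> E"
    and "proper_2coloring E black"
  shows "\<exists>lab. strong_labeling V E rot out black lab"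
  using assms colored_quadrangulation.strong_labeling_exists colored_quadrangulation.intro by blast

end
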